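(* Let $\varphi$ be a formula and let $M=\langle W,\succeq,\mathbb{V}\rangle$ be a preference model with $M\not\models\varphi$. Let $M'=\langle W',\succeq',\mathbb{V}'\rangle$ be a preference model that rearranges $M$ with prototype function $prot\colon W'\to W$. Suppose the following four conditions hold: (i) there exists $v'\in W'$ such that $M,prot(v')\not\models\varphi$; (ii) for every $\Box\beta\in\mathit{Box}^-(\varphi,M)$ there exists $v'\in W'$ such that $M,prot(v')\not\models\beta$; (iii) for every $\mathcal{O}(\gamma\mid\alpha)\in\mathit{Ob}^-(\varphi,M)$ there exists $v'\in W'$ such that $prot(v')\in\max_{\succ}(\|\alpha\|_M)\setminus\|\gamma\|_M$ and for all $u'\in W'$ with $u'\succ' v'$ we have $prot(u')\succ prot(v')$; (iv) for every $w'\in W'$ and every $\mathcal{O}(\gamma\mid\alpha)\in\mathit{Ob}^+(\varphi,M)$, if there exists $u\in W$ with $u\succ prot(w')$ and $M,u\models\alpha$, then there exists $s'\in W'$ with $s'\succ' w'$ and $M,prot(s')\models\alpha$. Then $M'\not\models\varphi$.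
   Context: Formulas are built from a set $\mathit{Var}$ of propositional variables by the grammar $x\in\mathit{Var}\mid\neg\psi\mid\psi_1\wedge\psi_2\mid\Box\psi\mid\mathcal{O}(\psi_1\mid\psi_2)$ (the last is a dyadic obligation "$\psi_1$ is obligatory given $\psi_2$"). $\mathrm{Sub}(\varphi)$ denotes the set of subformulas of $\varphi$ (including $\varphi$). A preference model is a triple $M=\langle W,\succeq,\mathbb{V}\rangle$ with $W$ a nonempty set, $\succeq$ an arbitrary binary relation on $W$, and $\mathbb{V}\colon\mathit{Var}\to\mathcal{P}(W)$. Write $w_1\succ w_2$ iff $w_1\succeq w_2$ and not $w_2\succeq w_1$ (similarly $\succ'$ from $\succeq'$). For $U\subseteq W$, $\max_{\succ}(U)=\{v\in U:\text{there is no }u\in U\text{ with }u\succ v\}$. Truth sets: $\|x\|_M=\mathbb{V}(x)$; $\|\neg\psi\|_M=W\setminus\|\psi\|_M$; $\|\psi_1\wedge\psi_2\|_M=\|\psi_1\|_M\cap\|\psi_2\|_M$; $\|\Box\beta\|_M=W$ if $\|\beta\|_M=W$ and $\emptyset$ otherwise; $\|\mathcal{O}(\gamma\mid\alpha)\|_M=W$ if $\max_{\succ}(\|\alpha\|_M)\subseteq\|\gamma\|_M$ and $\emptyset$ otherwise. $M,w\models\psi$ means $w\in\|\psi\|_M$, and $M\models\psi$ means $\|\psi\|_M=W$. $\mathit{Box}^+(\varphi,M)$ (resp. $\mathit{Box}^-(\varphi,M)$) is the set of subformulas of $\varphi$ of the form $\Box\beta$ with $M\models\Box\beta$ (resp.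 $M\not\models\Box\beta$); $\mathit{Ob}^+(\varphi,M)$ and $\mathit{Ob}^-(\varphi,M)$ are defined likewise for subformulas of the form $\mathcal{O}(\gamma\mid\alpha)$. A model $M'=\langle W',\succeq',\mathbb{V}'\rangle$ rearranges $M$ with prototype function $prot\colon W'\to W$ if for all $w'\in W'$ and all $x\in\mathit{Var}$: $w'\in\mathbb{V}'(x)$ iff $prot(w')\in\mathbb{V}(x)$. *)

theory Defs
  imports Main "HOL-Library.FuncSet"
begin

text \<open>\<open>Obl \<psi>1 \<psi>2\<close> is the dyadic obligation \<open>\<O>(\<psi>1 | \<psi>2)\<close>: the obligation comes first,
  its condition second.\<close>

datatype 'x fm =
    Var 'x
  | Neg "'x fm"
  | Conj "'x fm" "'x fm"
  | Box "'x fm"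
  | Obl "'x fm" "'x fm"

primrec Sub :: "'x fm \<Rightarrow> 'x fm set" where
  "Sub (Var x) = {Var x}"
| "Sub (Neg \<psi>) = insert (Neg \<psi>) (Sub \<psi>)"
| "Sub (Conj \<psi>1 \<psi>2) = insert (Conj \<psi>1 \<psi>2) (Sub \<psi>1 \<union> Sub \<psi>2)"
| "Sub (Box \<psi>) = insert (Box \<psi>) (Sub \<psi>)"
| "Sub (Obl \<psi>1 \<psi>2) = insert (Obl \<psi>1 \<psi>2) (Sub \<psi>1 \<union> Sub \<psi>2)"

text \<open>\<open>(u, v) \<in> pref M\<close> stands for \<open>u \<succeq> v\<close>.\<close>

record ('w, 'x) model =
  worlds :: "'w set"
  pref :: "('w \<times> 'w) set"
  val :: "'x \<Rightarrow> 'w set"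

definition pref_model :: "('w, 'x) model \<Rightarrow> bool" where
  "pref_model M \<longleftrightarrow>
     worlds M \<noteq> {} \<and> pref M \<subseteq> worlds M \<times> worlds M \<and> (\<forall>x. val M x \<subseteq> worlds M)"

definition better :: "('w, 'x) model \<Rightarrow> 'w \<Rightarrow> 'w \<Rightarrow> bool" where
  "better M u v \<longleftrightarrow> (u, v) \<in> pref M \<and> (v, u) \<notin> pref M"

definition max_worlds :: "('w, 'x) model \<Rightarrow> 'w set \<Rightarrow> 'w set" where
  "max_worlds M U = {v \<in> U. \<not> (\<exists>u \<in> U. better M u v)}"

primrec truth_set :: "('w, 'x) model \<Rightarrow> 'x fm \<Rightarrow> 'w set" where
  "truth_set M (Var x) = val M x"
| "truth_set M (Neg \<psi>) = worlds M - truth_set M \<psi>"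
| "truth_set M (Conj \<psi>1 \<psi>2) = truth_set M \<psi>1 \<inter> truth_set M \<psi>2"
| "truth_set M (Box \<beta>) = (if truth_set M \<beta> = worlds M then worlds M else {})"
| "truth_set M (Obl \<gamma> \<alpha>) =
     (if max_worlds M (truth_set M \<alpha>) \<subseteq> truth_set M \<gamma> then worlds M else {})"

definition sat :: "('w, 'x) model \<Rightarrow> 'w \<Rightarrow> 'x fm \<Rightarrow> bool" where
  "sat M w \<psi> \<longleftrightarrow> w \<in> truth_set M \<psi>"

definition valid_in :: "('w, 'x) model \<Rightarrow> 'x fm \<Rightarrow> bool" where
  "valid_in M \<psi> \<longleftrightarrow> truth_set M \<psi> = worlds M"

definition Box_plus :: "'x fm \<Rightarrow> ('w, 'x) model \<Rightarrow> 'x fm set" where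
  "Box_plus \<phi> M = {Box \<beta> | \<beta>. Box \<beta> \<in> Sub \<phi> \<and> valid_in M (Box \<beta>)}"

definition Box_minus :: "'x fm \<Rightarrow> ('w, 'x) model \<Rightarrow> 'x fm set" where
  "Box_minus \<phi> M = {Box \<beta> | \<beta>. Box \<beta> \<in> Sub \<phi> \<and> \<not> valid_in M (Box \<beta>)}"

definition Ob_plus :: "'x fm \<Rightarrow> ('w, 'x) model \<Rightarrow> 'x fm set" where
  "Ob_plus \<phi> M = {Obl \<gamma> \<alpha> | \<gamma> \<alpha>. Obl \<gamma> \<alpha> \<in> Sub \<phi> \<and> valid_in M (Obl \<gamma> \<alpha>)}"

definition Ob_minus :: "'x fm \<Rightarrow> ('w, 'x) model \<Rightarrow> 'x fm set" where
  "Ob_minus \<phi> M = {Obl \<gamma> \<alpha> | \<gamma> \<alpha>. Obl \<gamma> \<alpha> \<in> Sub \<phi> \<and> \<not> valid_in M (Obl \<gamma> \<alpha>)}"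

definition rearranges :: "('v, 'x) model \<Rightarrow> ('w, 'x) model \<Rightarrow> ('v \<Rightarrow> 'w) \<Rightarrow> bool" where
  "rearranges M' M prot \<longleftrightarrow>
     prot \<in> worlds M' \<rightarrow> worlds M \<and>
     (\<forall>w' \<in> worlds M'. \<forall>x. w' \<in> val M' x \<longleftrightarrow> prot w' \<in> val M x)"

end

theory Submission
  imports Defs
begin

text \<open>Each world of \<open>M'\<close> is a copy of its prototype and satisfies the same
  subformulas of \<open>\<phi>\<close> (\<open>truth_set_prot_iff\<close>), so a copy of a world
  refuting \<open>\<phi>\<close>, supplied by (i), refutes \<open>\<phi>\<close> in
  \<open>M'\<close>. For variables and Boolean connectives this is immediate. Boxes and obligations
  hold everywhere or nowhere, so it suffices that \<open>M\<close> and \<open>M'\<close> agree on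
  their validity. A valid box survives because every world of \<open>M'\<close> copies one of
  \<open>M\<close>; (ii) keeps a counterexample to an invalid one. By (iii) some counterexample to
  an invalid obligation stays maximal in \<open>M'\<close>; by (iv) no copy of a non-maximal world
  becomes maximal for the condition of a valid one.\<close>

lemma truth_set_subset_worlds:
  assumes "pref_model M"
  shows "truth_set M \<psi> \<subseteq> worlds M"
  using assms by (induction \<psi>) (auto simp: pref_model_def)

text \<open>Nonemptiness of \<open>worlds M\<close> keeps the two values \<open>worlds M\<close> and
  \<open>{}\<close> apart; the same holds for obligations below.\<close>

lemma valid_in_Box_iff:
  assumes "pref_model M"
  shows "valid_in M (Box \<beta>) \<longleftrightarrow> truth_set M \<beta> = worlds M"
  using assms by (auto simp: valid_in_def pref_model_def)

lemma valid_in_Obl_iff: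
  assumes "pref_model M"
  shows "valid_in M (Obl \<gamma> \<alpha>) \<longleftrightarrow> max_worlds M (truth_set M \<alpha>) \<subseteq> truth_set M \<gamma>"
  using assms by (auto simp: valid_in_def pref_model_def)

text \<open>Induction on \<open>\<psi>\<close>, with (ii)-(iv) settling the modal cases. The bound
  \<open>Sub \<psi> \<subseteq> Sub \<phi>\<close> passes directly to components, so no transitivity
  of the subformula relation has to be proved.\<close>

lemma truth_set_prot_iff:
  fixes M :: "('w, 'x) model" and M' :: "('v, 'x) model"
  assumes M: "pref_model M" and M': "pref_model M'"
    and re: "rearranges M' M prot"
    and box: "\<And>\<beta>. Box \<beta> \<in> Box_minus \<phi> M \<Longrightarrow> \<exists>v' \<in> worlds M'. \<not> sat M (prot v') \<beta>"
    and ob_minus: "\<And>\<gamma> \<alpha>. Obl \<gamma> \<alpha> \<in> Ob_minus \<phi> M \<Longrightarrow>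
      \<exists>v' \<in> worlds M'.
        prot v' \<in> max_worlds M (truth_set M \<alpha>) - truth_set M \<gamma> \<and>
        (\<forall>u' \<in> worlds M'. better M' u' v' \<longrightarrow> better M (prot u') (prot v'))"
    and ob_plus: "\<And>w' \<gamma> \<alpha>. w' \<in> worlds M' \<Longrightarrow> Obl \<gamma> \<alpha> \<in> Ob_plus \<phi> M \<Longrightarrow>
      \<exists>u \<in> worlds M. better M u (prot w') \<and> sat M u \<alpha> \<Longrightarrow>
      \<exists>s' \<in> worlds M'. better M' s' w' \<and> sat M (prot s') \<alpha>"
    and "Sub \<psi> \<subseteq> Sub \<phi>" and "w' \<in> worlds M'"
  shows "w' \<in> truth_set M' \<psi> \<longleftrightarrow> prot w' \<in> truth_set M \<psi>"
  using \<open>Sub \<psi> \<subseteq> Sub \<phi>\<close> \<open>w' \<in> worlds M'\<close>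
\<comment> \<open>A modal formula at one world depends on its components at all worlds, so
  \<open>w'\<close> must vary in the induction hypothesis.\<close>
proof (induction \<psi> arbitrary: w')
  case (Var x)
  then show ?case using re by (auto simp: rearranges_def)
next
  case (Neg \<psi>)
  then show ?case using re by (auto simp: rearranges_def)
next
  case (Conj \<psi>1 \<psi>2)
  then show ?case by simp
next
  case (Box \<beta>)
  have prot: "prot v \<in> worlds M" if "v \<in> worlds M'" for v
    using re that by (auto simp: rearranges_def)
  have IH: "v \<in> truth_set M' \<beta> \<longleftrightarrow> prot v \<in> truth_set M \<beta>" if "v \<in> worlds M'" for v
    using Box.IH Box.prems(1) that by simp
  have "truth_set M' \<beta> = worlds M' \<longleftrightarrow> truth_set M \<beta> = worlds M"
  proof
    assume valid': "truth_set M' \<beta> = worlds M'"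
    show "truth_set M \<beta> = worlds M"
    proof (rule ccontr)
      assume "truth_set M \<beta> \<noteq> worlds M"
      then have "Box \<beta> \<in> Box_minus \<phi> M"
        using Box.prems(1) by (auto simp: Box_minus_def valid_in_Box_iff[OF M])
      then show False
        using box IH valid' by (auto simp: sat_def)
    qed
  next
    assume "truth_set M \<beta> = worlds M"
    then show "truth_set M' \<beta> = worlds M'"
      using IH prot truth_set_subset_worlds[OF M'] by blast
  qed
  \<comment> \<open>Both truth sets are now full or both empty, and \<open>w'\<close> and
    \<open>prot w'\<close> are worlds of their models.\<close>
  then show ?case using Box.prems(2) prot by simp
next
  case (Obl \<gamma> \<alpha>)
  have prot: "prot v \<in> worlds M" if "v \<in> worlds M'" for v
    using re that by (auto simp: rearranges_def)
  have IH: "v \<in> truth_set M' \<gamma> \<longleftrightarrow> prot v \<in> truth_set M \<gamma>"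
    "v \<in> truth_set M' \<alpha> \<longleftrightarrow> prot v \<in> truth_set M \<alpha>" if "v \<in> worlds M'" for v
    using Obl.IH Obl.prems(1) that by simp_all
  have sub: "Obl \<gamma> \<alpha> \<in> Sub \<phi>" using Obl.prems(1) by simp
  note in_worlds = truth_set_subset_worlds[OF M, THEN subsetD]
    truth_set_subset_worlds[OF M', THEN subsetD]
  have "max_worlds M' (truth_set M' \<alpha>) \<subseteq> truth_set M' \<gamma> \<longleftrightarrow>
    max_worlds M (truth_set M \<alpha>) \<subseteq> truth_set M \<gamma>"
  proof
    assume sub': "max_worlds M' (truth_set M' \<alpha>) \<subseteq> truth_set M' \<gamma>"
    show "max_worlds M (truth_set M \<alpha>) \<subseteq> truth_set M \<gamma>"
    proof (rule ccontr)
      assume "\<not> max_worlds M (truth_set M \<alpha>) \<subseteq> truth_set M \<gamma>"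
      then have "Obl \<gamma> \<alpha> \<in> Ob_minus \<phi> M"
        using sub by (auto simp: Ob_minus_def valid_in_Obl_iff[OF M])
      then obtain v where v: "v \<in> worlds M'"
        "prot v \<in> max_worlds M (truth_set M \<alpha>)" "prot v \<notin> truth_set M \<gamma>"
        and mono: "\<forall>u \<in> worlds M'. better M' u v \<longrightarrow> better M (prot u) (prot v)"
        using ob_minus by blast
      \<comment> \<open>A better \<open>\<alpha>\<close>-world \<open>u\<close> in \<open>M'\<close>
        would yield \<open>prot u\<close>, an \<open>\<alpha>\<close>-world better than
        \<open>prot v\<close>, against the maximality of \<open>prot v\<close>.\<close>
      have "v \<in> max_worlds M' (truth_set M' \<alpha>)"
        using v mono IH(2) in_worlds(2) unfolding max_worlds_def by blast
      then show False using sub' v IH(1) by blast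
    qed
  next
    assume sub_M: "max_worlds M (truth_set M \<alpha>) \<subseteq> truth_set M \<gamma>"
    then have plus: "Obl \<gamma> \<alpha> \<in> Ob_plus \<phi> M"
      using sub by (auto simp: Ob_plus_def valid_in_Obl_iff[OF M])
    show "max_worlds M' (truth_set M' \<alpha>) \<subseteq> truth_set M' \<gamma>"
    proof
      fix v assume v: "v \<in> max_worlds M' (truth_set M' \<alpha>)"
      then have vW: "v \<in> worlds M'" using in_worlds by (auto simp: max_worlds_def)
      \<comment> \<open>Otherwise (iv) gives a world of \<open>M'\<close> better than
        \<open>v\<close> whose prototype satisfies \<open>\<alpha>\<close>; by \<open>IH(2)\<close>
        it satisfies \<open>\<alpha>\<close> itself, so \<open>v\<close> is not maximal.\<close>
      have "\<not> (\<exists>u \<in> truth_set M \<alpha>. better M u (prot v))"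
        using ob_plus[OF vW plus] v IH(2) in_worlds
        unfolding max_worlds_def sat_def by blast
      then have "prot v \<in> max_worlds M (truth_set M \<alpha>)"
        using v vW IH(2) by (auto simp: max_worlds_def)
      then show "v \<in> truth_set M' \<gamma>" using sub_M vW IH(1) by blast
    qed
  qed
  then show ?case using Obl.prems(2) prot by simp
qed

theorem theorem3p2:
  fixes \<phi> :: "'x fm"
    and M :: "('w, 'x) model"
    and M' :: "('v, 'x) model"
    and prot :: "'v \<Rightarrow> 'w"
  assumes "pref_model M"
    and "\<not> valid_in M \<phi>"
    and "pref_model M'"
    and "rearranges M' M prot"
    and i: "\<exists>v' \<in> worlds M'. \<not> sat M (prot v') \<phi>"
    and ii: "\<And>\<beta>. Box \<beta> \<in> Box_minus \<phi> M \<Longrightarrow> \<exists>v' \<in> worlds M'. \<not> sat M (prot v') \<beta>"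
    and iii: "\<And>\<gamma> \<alpha>. Obl \<gamma> \<alpha> \<in> Ob_minus \<phi> M \<Longrightarrow>
      \<exists>v' \<in> worlds M'.
        prot v' \<in> max_worlds M (truth_set M \<alpha>) - truth_set M \<gamma> \<and>
        (\<forall>u' \<in> worlds M'. better M' u' v' \<longrightarrow> better M (prot u') (prot v'))"
    and iv: "\<And>w' \<gamma> \<alpha>. w' \<in> worlds M' \<Longrightarrow> Obl \<gamma> \<alpha> \<in> Ob_plus \<phi> M \<Longrightarrow>
      \<exists>u \<in> worlds M. better M u (prot w') \<and> sat M u \<alpha> \<Longrightarrow>
      \<exists>s' \<in> worlds M'. better M' s' w' \<and> sat M (prot s') \<alpha>"
  shows "\<not> valid_in M' \<phi>"
proof
  assume "valid_in M' \<phi>"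
  moreover obtain v' where "v' \<in> worlds M'" "prot v' \<notin> truth_set M \<phi>"
    using i by (auto simp: sat_def)
  moreover have "v' \<in> truth_set M' \<phi> \<longleftrightarrow> prot v' \<in> truth_set M \<phi>"
    by (rule truth_set_prot_iff[OF assms(1,3,4) ii iii iv subset_refl \<open>v' \<in> worlds M'\<close>])
  ultimately show False by (simp add: valid_in_def)
qed

end
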